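(* (a) Let $j\ge 1$ be a fixed integer and define $$\delta_j:=\Bigl(\frac{2j^{2}}{(j+1)(2j+1)}\log\frac{2j}{2j+1}+\frac{3j+1}{(j+1)(2j+1)}\log\frac{3j+1}{2j+1}\Bigr)\Big/\log(j+1).$$ Then for every integer $k\ge 1$ and every integer $n\ge 1$, $$E_{j,k}(n)\le k\,\kappa_j(n)^{1-\delta_j}.$$ (b) Let $\delta:=0.045072$. For every integer $k\ge1$ and every integer $n\ge 1$, $$E_{2,k}(n)\le k\,\kappa_2(n)^{1-\delta}.$$
   Context: For an integer $n\ge1$, $\mathcal{D}_n$ denotes the set of positive divisors of $n$. For $j\ge1$, $\kappa_j(n)$ is the number of $j$-tuples $(d_1,\dots,d_j)\in\mathcal{D}_n^j$ with $\gcd(d_{i_1},d_{i_2})=1$ for all $i_1\ne i_2$; equivalently $\kappa_j(n)=\prod_{p^v\| n}(jv+1)$. A set $U\subseteq\mathcal{D}_n^j$ is called regular if every tuple in $U$ has pairwise coprime entries. For an integer $k\ge1$, a map $g:U_g\to\mathcal{D}_n$ defined on a regular set $U_g\subseteq \mathcal{D}_n^j$ is called $k$-regular if (0) for every $(d_1,\dots,d_j)\in U_g$ one has $\gcd(g(d_1,\dots,d_j),d_i)=1$ for each $i=1,\dots,j$; (1) for each $1\le i\le j$, and each fixed choice of $d_1,\dots,d_{i-1},d_{i+1},\dots,d_j$ and $d$, the equation $g(d_1,\dots,d_{i-1},z,d_{i+1},\dots,d_j)=d$ has at most $k$ solutions $z$ with $(d_1,\dots,d_{i-1},z,d_{i+1},\dots,d_j)\in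 U_g$; (2) for each $1\le i\le j$, and each fixed choice of $d_1,\dots,d_{i-1},d_{i+1},\dots,d_j$ and $d$, the equation $z\,g(d_1,\dots,d_{i-1},z,d_{i+1},\dots,d_j)=d$ has at most $k$ solutions $z$ with $(d_1,\dots,d_{i-1},z,d_{i+1},\dots,d_j)\in U_g$. Then $E_{j,k}(n)$ is the maximum of $|U_g|$ over all $k$-regular maps $g$ (for the given $j$, $n$). *)

theory Defs
  imports Complex_Main "HOL-Library.FuncSet"
begin

definition divs :: "nat \<Rightarrow> nat set" where
  "divs n = {d. 0 < d \<and> d dvd n}"

(* A j-tuple (d_1, ..., d_j) is an extensional function on {1..j}, so that d(i := z) replaces
   its i-th entry by z. *)
definition tuples :: "nat \<Rightarrow> nat \<Rightarrow> (nat \<Rightarrow> nat) set" where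
  "tuples j n = {1..j} \<rightarrow>\<^sub>E divs n"

definition coprime_tuple :: "nat \<Rightarrow> (nat \<Rightarrow> nat) \<Rightarrow> bool" where
  "coprime_tuple j d \<longleftrightarrow> pairwise (\<lambda>i i'. coprime (d i) (d i')) {1..j}"

definition kappa :: "nat \<Rightarrow> nat \<Rightarrow> nat" where
  "kappa j n = card {d \<in> tuples j n. coprime_tuple j d}"

definition regular_set :: "nat \<Rightarrow> nat \<Rightarrow> (nat \<Rightarrow> nat) set \<Rightarrow> bool" where
  "regular_set j n U \<longleftrightarrow> U \<subseteq> tuples j n \<and> (\<forall>d\<in>U. coprime_tuple j d)"

(* The values of g outside its domain U are irrelevant. In the last two conditions the i-th entry
   of x is irrelevant: only the remaining entries are being fixed. *)
definition regular_map ::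
  "nat \<Rightarrow> nat \<Rightarrow> nat \<Rightarrow> (nat \<Rightarrow> nat) set \<Rightarrow> ((nat \<Rightarrow> nat) \<Rightarrow> nat) \<Rightarrow> bool" where
  "regular_map j k n U g \<longleftrightarrow>
     regular_set j n U \<and>
     g \<in> U \<rightarrow> divs n \<and>
     (\<forall>d\<in>U. \<forall>i\<in>{1..j}. coprime (g d) (d i)) \<and>
     (\<forall>i\<in>{1..j}. \<forall>x\<in>tuples j n. \<forall>m.
        card {z. x(i := z) \<in> U \<and> g (x(i := z)) = m} \<le> k) \<and>
     (\<forall>i\<in>{1..j}. \<forall>x\<in>tuples j n. \<forall>m.
        card {z. x(i := z) \<in> U \<and> z * g (x(i := z)) = m} \<le> k)"

definition E :: "nat \<Rightarrow> nat \<Rightarrow> nat \<Rightarrow> nat" where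
  "E j k n = Max {card U | U. \<exists>g. regular_map j k n U g}"

definition delta :: "nat \<Rightarrow> real" where
  "delta j =
     (2 * real j ^ 2 / ((real j + 1) * (2 * real j + 1)) * ln (2 * real j / (2 * real j + 1))
      + (3 * real j + 1) / ((real j + 1) * (2 * real j + 1))
          * ln ((3 * real j + 1) / (2 * real j + 1)))
     / ln (real j + 1)"

lemma finite_divs: "n \<ge> 1 \<Longrightarrow> finite (divs n)"
  by (simp add: divs_def)

lemma finite_tuples: "n \<ge> 1 \<Longrightarrow> finite (tuples j n)"
  by (simp add: tuples_def finite_PiE finite_divs)

(* The maximum defining E, and the cardinalities in regular_map, are over finite sets;
   the former is over a nonempty one. *)
lemma regular_map_sizes_finite:
  assumes "n \<ge> 1"
  shows "finite {card U | U. \<exists>g. regular_map j k n U g}"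
proof (rule finite_subset)
  show "{card U | U. \<exists>g. regular_map j k n U g} \<subseteq> card ` Pow (tuples j n)"
    by (auto simp: regular_map_def regular_set_def)
  show "finite (card ` Pow (tuples j n))"
    using assms by (simp add: finite_tuples)
qed

lemma regular_map_sizes_nonempty: "{card U | U. \<exists>g. regular_map j k n U g} \<noteq> {}"
proof -
  have "regular_map j k n {} g" for g
    by (simp add: regular_map_def regular_set_def)
  then show ?thesis by blast
qed

lemma regular_map_solutions_finite:
  assumes "n \<ge> 1" "regular_map j k n U g" "i \<in> {1..j}"
  shows "finite {z. x(i := z) \<in> U}"
proof (rule finite_subset[OF _ finite_divs[OF assms(1)]])
  show "{z. x(i := z) \<in> U} \<subseteq> divs n"
  proof
    fix z assume "z \<in> {z. x(i := z) \<in> U}"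
    then have "x(i := z) \<in> {1..j} \<rightarrow>\<^sub>E divs n"
      using assms(2) by (auto simp: regular_map_def regular_set_def tuples_def)
    from PiE_mem[OF this assms(3)] show "z \<in> divs n" by simp
  qed
qed

end

theory Submission
  imports Defs "HOL-Computational_Algebra.Primes"
begin

text \<open>Each of the \<open>2 j + 1\<close> maps \<open>d\<close>, \<open>d(i := g d)\<close>, \<open>d(i := d i * g d)\<close> from \<open>U\<close> to the pairwise coprime
  tuples is at most \<open>k\<close>-to-one. Hence, for any probability weight on the pairwise coprime tuples,
  the sum over \<open>U\<close> of the weights of the images is at most \<open>k\<close>. Choose weights that are products over
  the primes dividing \<open>n\<close>. By the inequality between arithmetic and geometric means, if the product
  of the \<open>2 j + 1\<close> image weights of every \<open>d\<close> is at least \<open>\<kappa>\<close> to the power \<open>- (2 j + 1) (1 - \<delta>)\<close>,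
  then \<open>card U\<close> is at most \<open>k\<close> times \<open>\<kappa>\<close> to the power \<open>1 - \<delta>\<close>. This condition is local: it suffices
  to choose, for each exponent \<open>v\<close>, three parameters of the weight at a prime.\<close>

section \<open>Pairwise coprime tuples\<close>

definition coprime_tuples :: "nat \<Rightarrow> nat \<Rightarrow> (nat \<Rightarrow> nat) set" where
  "coprime_tuples j n = {d \<in> tuples j n. coprime_tuple j d}"

text \<open>For a prime and a pairwise coprime tuple the choice made by \<open>SOME\<close> is
  unique, see \<open>slot_eq\<close>. Entries are numbered from 1, so 0 is free to mean that no
  entry is divisible.\<close>

definition slot :: "nat \<Rightarrow> (nat \<Rightarrow> nat) \<Rightarrow> nat \<Rightarrow> nat" where
  "slot j d p = (if \<exists>i\<in>{1..j}. p dvd d i then SOME i. i \<in> {1..j} \<and> p dvd d i else 0)"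

lemma slot_eq_0: "(\<And>i. i \<in> {1..j} \<Longrightarrow> \<not> p dvd d i) \<Longrightarrow> slot j d p = 0"
  by (auto simp: slot_def)

lemma slot_in:
  assumes "slot j d p \<noteq> 0"
  shows "slot j d p \<in> {1..j} \<and> p dvd d (slot j d p)"
proof -
  have *: "\<exists>i\<in>{1..j}. p dvd d i" using assms by (auto simp: slot_def split: if_splits)
  then have "\<exists>i. i \<in> {1..j} \<and> p dvd d i" by blast
  from someI_ex[OF this] show ?thesis using * by (simp add: slot_def)
qed

lemma slot_eq:
  assumes "coprime_tuple j d" "prime p" "i \<in> {1..j}" "p dvd d i"
  shows "slot j d p = i"
proof (rule ccontr)
  assume ne: "slot j d p \<noteq> i"
  have "\<exists>i. i \<in> {1..j} \<and> p dvd d i" using assms by blast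
  from someI_ex[OF this] have s: "slot j d p \<in> {1..j}" "p dvd d (slot j d p)"
    using assms by (auto simp: slot_def)
  have "coprime (d (slot j d p)) (d i)"
    using assms(1,3) s(1) ne by (auto simp: coprime_tuple_def pairwise_def)
  then show False
    using s(2) assms(2,4) by (meson coprime_common_divisor not_prime_unit)
qed

lemma finite_coprime_tuples: "n \<ge> 1 \<Longrightarrow> finite (coprime_tuples j n)"
  by (simp add: coprime_tuples_def finite_tuples)

lemma tuple_entry: "d \<in> tuples j n \<Longrightarrow> i \<in> {1..j} \<Longrightarrow> 0 < d i \<and> d i dvd n"
  using PiE_mem[of d "{1..j}" "\<lambda>_. divs n" i] by (simp add: tuples_def divs_def)

lemma coprime_tupleI:
  assumes "\<And>i i' p. prime p \<Longrightarrow> i \<in> {1..j} \<Longrightarrow> i' \<in> {1..j} \<Longrightarrow> p dvd d i \<Longrightarrow> p dvd d i' \<Longrightarrow> i = i'"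
  shows "coprime_tuple j d"
  unfolding coprime_tuple_def pairwise_def
proof (intro ballI impI)
  fix i i' assume i: "i \<in> {1..j}" "i' \<in> {1..j}" "i \<noteq> i'"
  show "coprime (d i) (d i')"
  proof (rule ccontr)
    assume "\<not> coprime (d i) (d i')"
    then have "gcd (d i) (d i') \<noteq> 1" by (simp add: coprime_iff_gcd_eq_1)
    then obtain p where "prime p" "p dvd gcd (d i) (d i')" using prime_factor_nat by blast
    then show False using assms[of p i i'] i by auto
  qed
qed

text \<open>A pairwise coprime tuple amounts to choosing, for every prime \<open>p\<close> dividing \<open>n\<close>, either
  \<open>(0, 0)\<close> or a pair consisting of the entry that \<open>p\<close> divides and the exponent of \<open>p\<close> there.\<close>

lemma sum_coprime_tuples:
  fixes a :: "nat \<Rightarrow> nat \<Rightarrow> real"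
  assumes n: "n \<ge> 1"
  shows "(\<Sum>d\<in>coprime_tuples j n. \<Prod>p\<in>prime_factors n. a p (slot j d p)) =
         (\<Prod>p\<in>prime_factors n. a p 0 + real (multiplicity p n) * (\<Sum>i=1..j. a p i))"
proof -
  define P where "P = prime_factors n"
  define B where "B p = insert (0::nat, 0::nat) ({1..j} \<times> {1..multiplicity p n})" for p
  \<comment> \<open>\<open>dec\<close> assembles a tuple from the local choices and
    \<open>enc\<close> reads them off again. They are mutually inverse between
    \<open>PiE P B\<close> and the coprime tuples, so expanding the product of local sums gives the
    claim.\<close>
  define dec :: "(nat \<Rightarrow> nat \<times> nat) \<Rightarrow> nat \<Rightarrow> nat" where
    "dec f = restrict (\<lambda>i. \<Prod>p\<in>P. p ^ (if fst (f p) = i then snd (f p) else 0)) {1..j}" for f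
  define enc where
    "enc d = restrict (\<lambda>p. (slot j d p, if slot j d p = 0 then 0 else multiplicity p (d (slot j d p)))) P" for d
  have P: "finite P" "\<And>p. p \<in> P \<Longrightarrow> prime p" and Pd: "\<And>p. p \<in> P \<longleftrightarrow> prime p \<and> p dvd n"
    using n by (auto simp: P_def prime_factors_dvd)
  \<comment> \<open>The weight ignores the exponent, so each entry is counted
    \<open>multiplicity p n\<close> times.\<close>
  have local: "a p 0 + real (multiplicity p n) * (\<Sum>i=1..j. a p i) = (\<Sum>s\<in>B p. a p (fst s))" for p
  proof -
    have "(\<Sum>s\<in>{1..j} \<times> {1..multiplicity p n}. a p (fst s))
        = (\<Sum>i\<in>{1..j}. \<Sum>e\<in>{1..multiplicity p n}. a p i)"
      by (subst sum.cartesian_product) (simp add: case_prod_unfold)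
    then show ?thesis
      unfolding B_def by (subst sum.insert) (auto simp: sum_distrib_left)
  qed
  have mult_dec: "multiplicity p (dec f i) = (if p \<in> P \<and> fst (f p) = i then snd (f p) else 0)"
    and dec_pos: "dec f i > 0"
    if "prime p" "i \<in> {1..j}" for f p i
  proof -
    show "multiplicity p (dec f i) = (if p \<in> P \<and> fst (f p) = i then snd (f p) else 0)"
      using that P by (auto simp: dec_def multiplicity_prod_prime_powers)
    show "dec f i > 0"
      using that P by (auto simp: dec_def intro!: prod_pos prime_gt_0_nat)
  qed
  have dvd_iff: "p dvd dec f i \<longleftrightarrow> p \<in> P \<and> fst (f p) = i"
    if "f \<in> PiE P B" "prime p" "i \<in> {1..j}" for f p i
  proof -
    have "p dvd dec f i \<longleftrightarrow> multiplicity p (dec f i) > 0"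
      using that dec_pos[of p i f] by (subst prime_multiplicity_gt_zero_iff) auto
    also have "\<dots> \<longleftrightarrow> p \<in> P \<and> fst (f p) = i"
      using that PiE_mem[OF that(1), of p] by (auto simp: mult_dec B_def)
    finally show ?thesis .
  qed
  have cop_dec: "coprime_tuple j (dec f)" if "f \<in> PiE P B" for f
    by (rule coprime_tupleI) (use that in \<open>auto simp: dvd_iff\<close>)
  have slot_dec: "slot j (dec f) p = fst (f p)" if "f \<in> PiE P B" "p \<in> P" for f p
  proof (cases "fst (f p) = 0")
    case True
    then show ?thesis
      using that P by (subst slot_eq_0) (auto simp: dvd_iff)
  next
    case False
    then have "fst (f p) \<in> {1..j}" using PiE_mem[OF that] by (auto simp: B_def)
    then show ?thesis
      using that P cop_dec[OF that(1)] by (intro slot_eq) (auto simp: dvd_iff)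
  qed
  have dec_in: "dec f \<in> coprime_tuples j n" if f: "f \<in> PiE P B" for f
  proof -
    have "dec f i dvd n" if i: "i \<in> {1..j}" for i
    proof (rule multiplicity_le_imp_dvd)
      \<comment> \<open>\<open>dec_pos\<close> is stated relative to a prime; 2 serves as
        one.\<close>
      show "dec f i \<noteq> 0" using dec_pos[of 2 i f] i by simp
      fix p :: nat assume p: "prime p"
      show "multiplicity p (dec f i) \<le> multiplicity p n"
        using p i PiE_mem[OF f, of p] by (auto simp: mult_dec B_def)
    qed
    moreover have "dec f i > 0" if "i \<in> {1..j}" for i using dec_pos[of 2 i f] that by simp
    ultimately have "dec f \<in> tuples j n"
      unfolding tuples_def divs_def by (intro PiE_I) (auto simp: dec_def)
    then show ?thesis using cop_dec[OF f] by (simp add: coprime_tuples_def)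
  qed
  have enc_in: "enc d \<in> PiE P B" if d: "d \<in> coprime_tuples j n" for d
  proof (rule PiE_I)
    fix p assume p: "p \<in> P"
    show "enc d p \<in> B p"
    proof (cases "slot j d p = 0")
      case True then show ?thesis using p by (simp add: enc_def B_def)
    next
      case False
      note s = slot_in[OF False]
      have "d (slot j d p) > 0" "d (slot j d p) dvd n"
        using d s tuple_entry[of d j n] by (auto simp: coprime_tuples_def)
      then have "multiplicity p (d (slot j d p)) \<le> multiplicity p n"
        "multiplicity p (d (slot j d p)) > 0"
        using s n P(2)[OF p]
        by (auto intro!: dvd_imp_multiplicity_le simp: prime_multiplicity_gt_zero_iff)
      then show ?thesis using p s False by (auto simp: enc_def B_def)
    qed
  qed (auto simp: enc_def)
  have dec_enc: "dec (enc d) = d" if d: "d \<in> coprime_tuples j n" for d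
  proof
    fix i
    show "dec (enc d) i = d i"
    proof (cases "i \<in> {1..j}")
      case False
      have "d \<in> {1..j} \<rightarrow>\<^sub>E divs n" using d by (simp add: coprime_tuples_def tuples_def)
      from PiE_arb[OF this False] show ?thesis
        using False by (simp only: dec_def restrict_apply if_False)
    next
      case True
      have di: "d i > 0" "d i dvd n" using d True tuple_entry by (auto simp: coprime_tuples_def)
      show ?thesis
      proof (rule multiplicity_eq_nat)
        show "dec (enc d) i > 0" "d i > 0" using di dec_pos[of 2 i] True by auto
        fix p :: nat assume p: "prime p"
        show "multiplicity p (dec (enc d) i) = multiplicity p (d i)"
        proof (cases "p dvd d i")
          case False
          have "\<not> (slot j d p = i)" using slot_in[of j d p] False True by auto
          then show ?thesis
            using False p True by (simp add: mult_dec not_dvd_imp_multiplicity_0 enc_def)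
        next
          case pd: True
          then have "slot j d p = i" "p \<in> P"
            using p d True di by (auto simp: coprime_tuples_def Pd intro: slot_eq dvd_trans)
          then show ?thesis using p True by (simp add: mult_dec enc_def)
        qed
      qed
    qed
  qed
  have enc_dec: "enc (dec f) = f" if f: "f \<in> PiE P B" for f
  proof
    fix p
    show "enc (dec f) p = f p"
    proof (cases "p \<in> P")
      case False then show ?thesis using PiE_arb[OF f] by (simp add: enc_def)
    next
      case True
      then have "f p \<in> B p" using f by auto
      then show ?thesis
        using True P by (auto simp: enc_def slot_dec[OF f] B_def mult_dec)
    qed
  qed
  have "(\<Prod>p\<in>P. a p 0 + real (multiplicity p n) * (\<Sum>i=1..j. a p i)) =
        (\<Sum>f\<in>PiE P B. \<Prod>p\<in>P. a p (fst (f p)))"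
    unfolding local by (subst prod_sum_PiE) (auto simp: P B_def)
  also have "\<dots> = (\<Sum>d\<in>coprime_tuples j n. \<Prod>p\<in>P. a p (slot j d p))"
    by (rule sum.reindex_bij_witness[of _ enc dec])
       (auto simp: enc_dec dec_enc dec_in enc_in slot_dec intro!: prod.cong)
  finally show ?thesis by (simp add: P_def)
qed

text \<open>The constant weight 1 turns the weighted sum into a count.\<close>

lemma kappa_eq_prod:
  assumes "n \<ge> 1"
  shows "real (kappa j n) = (\<Prod>p\<in>prime_factors n. real (j * multiplicity p n + 1))"
  using sum_coprime_tuples[OF assms, where j = j and a = "\<lambda>_ _. 1"]
  by (simp add: kappa_def coprime_tuples_def algebra_simps)

section \<open>The maps that update one entry, and their fibres\<close>

lemma sum_compose_le:
  fixes w :: "'b \<Rightarrow> real"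
  assumes "finite S" "finite T" "\<And>x. x \<in> S \<Longrightarrow> f x \<in> T" "\<And>y. y \<in> T \<Longrightarrow> w y \<ge> 0"
    and "\<And>y. y \<in> T \<Longrightarrow> card {x \<in> S. f x = y} \<le> k"
  shows "(\<Sum>x\<in>S. w (f x)) \<le> real k * (\<Sum>y\<in>T. w y)"
proof -
  have "(\<Sum>x\<in>S. w (f x)) = (\<Sum>y\<in>T. \<Sum>x\<in>{x\<in>S. f x = y}. w (f x))"
    using assms by (subst sum.group) auto
  also have "\<dots> = (\<Sum>y\<in>T. real (card {x\<in>S. f x = y}) * w y)"
    by (intro sum.cong) auto
  also have "\<dots> \<le> (\<Sum>y\<in>T. real k * w y)"
    using assms by (intro sum_mono mult_right_mono) auto
  finally show ?thesis by (simp add: sum_distrib_left)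
qed

text \<open>An element of the fibre over \<open>e\<close> agrees with \<open>e\<close> off
  \<open>i\<close>, so it is \<open>e(i := z)\<close> for a \<open>z\<close> solving the equation of
  condition (1) or (2) with right-hand side \<open>e i\<close>.\<close>

lemma regular_map_fibre_le:
  assumes n: "n \<ge> 1" and reg: "regular_map j k n U g" and i: "i \<in> {1..j}"
    and e: "e \<in> tuples j n"
  shows "card {d \<in> U. d(i := g d) = e} \<le> k" "card {d \<in> U. d(i := d i * g d) = e} \<le> k"
proof -
  have fin: "finite {z. e(i := z) \<in> U}" using regular_map_solutions_finite[OF n reg i] .
  have *: "card {d \<in> U. d(i := h d) = e} \<le> k"
    if k: "card {z. e(i := z) \<in> U \<and> h (e(i := z)) = e i} \<le> k" for h
  proof -
    have "card {d \<in> U. d(i := h d) = e} \<le> card {z. e(i := z) \<in> U \<and> h (e(i := z)) = e i}"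
    proof (rule card_inj_on_le[where f = "\<lambda>d. d i"])
      show "inj_on (\<lambda>d. d i) {d \<in> U. d(i := h d) = e}"
        by (rule inj_onI) (auto simp: fun_eq_iff split: if_splits, metis)
      show "(\<lambda>d. d i) ` {d \<in> U. d(i := h d) = e} \<subseteq> {z. e(i := z) \<in> U \<and> h (e(i := z)) = e i}"
        by auto
      show "finite {z. e(i := z) \<in> U \<and> h (e(i := z)) = e i}"
        by (rule finite_subset[OF _ fin]) auto
    qed
    then show ?thesis using k by simp
  qed
  show "card {d \<in> U. d(i := g d) = e} \<le> k"
    using reg i e by (intro *) (auto simp: regular_map_def)
  show "card {d \<in> U. d(i := d i * g d) = e} \<le> k"
    using reg i e by (intro *) (auto simp: regular_map_def)
qed

text \<open>Condition (0) keeps the updated tuples pairwise coprime and makes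
  \<open>d i * g d\<close> a product of coprime divisors of \<open>n\<close>.\<close>

lemma regular_map_update_in:
  assumes reg: "regular_map j k n U g" and i: "i \<in> {1..j}" and d: "d \<in> U"
  shows "d(i := g d) \<in> coprime_tuples j n" "d(i := d i * g d) \<in> coprime_tuples j n"
proof -
  have t: "d \<in> tuples j n" "coprime_tuple j d" and g: "g d > 0" "g d dvd n"
    and c: "\<And>l. l \<in> {1..j} \<Longrightarrow> coprime (g d) (d l)"
    using reg d by (auto simp: regular_map_def regular_set_def divs_def)
  have di: "0 < d i" "d i dvd n" using tuple_entry[OF t(1) i] by auto
  have "d i * g d dvd n" using di g c[OF i] by (simp add: divides_mult coprime_commute)
  then have "d(i := g d) \<in> tuples j n" "d(i := d i * g d) \<in> tuples j n"
    using t(1) g di i by (auto simp: tuples_def PiE_def divs_def extensional_def Pi_def)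
  moreover have "coprime_tuple j (d(i := g d))" "coprime_tuple j (d(i := d i * g d))"
    using t(2) c i by (auto simp: coprime_tuple_def pairwise_def coprime_commute)
  ultimately show "d(i := g d) \<in> coprime_tuples j n" "d(i := d i * g d) \<in> coprime_tuples j n"
    by (auto simp: coprime_tuples_def)
qed

section \<open>Weights\<close>

text \<open>The weights at a prime with exponent \<open>v\<close> in \<open>n\<close>, scaled by \<open>j v + 1\<close>, are in terms of the
  slot \<open>c\<close> of the prime: for \<open>d\<close> itself, \<open>Z + v A\<close> if \<open>c = 0\<close> and \<open>B\<close> otherwise; for \<open>d(i := g d)\<close>,
  \<open>Z + v B\<close> if \<open>c = 0\<close>, \<open>A\<close> if \<open>c = i\<close> and \<open>B\<close> otherwise; for \<open>d(i := d i * g d)\<close>, \<open>Z\<close> if \<open>c = 0\<close>,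
  \<open>A + B\<close> if \<open>c = i\<close> and \<open>B\<close> otherwise. The three lower bounds are for the product of these
  \<open>2 j + 1\<close> weights if the prime divides no entry and not \<open>g d\<close>, if it divides \<open>g d\<close>, and if it
  divides some entry, respectively.\<close>

definition admissible :: "nat \<Rightarrow> nat \<Rightarrow> real \<Rightarrow> real \<Rightarrow> real \<Rightarrow> real \<Rightarrow> bool" where
  "admissible j v b Z A B \<longleftrightarrow>
     0 < Z \<and> 0 < A \<and> 0 < B \<and>
     Z + real v * A + real j * real v * B = real j * real v + 1 \<and>
     (real j * real v + 1) powr b \<le> (Z + real v * A) * (Z * (Z + real v * B)) ^ j \<and>
     (real j * real v + 1) powr b \<le> (Z + real v * A) * (A * (A + B)) ^ j \<and>
     (real j * real v + 1) powr b \<le> B ^ (2 * j - 1) * ((Z + real v * B) * (A + B))"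

text \<open>Logarithms make the conditions additive, so that they can be summed over the
  primes.\<close>

lemma admissible_ln:
  assumes "admissible j v b Z A B" "j \<ge> 1"
  defines "l \<equiv> b * ln (real j * real v + 1)"
  shows "l \<le> ln (Z + real v * A) + real j * (ln Z + ln (Z + real v * B))"
    and "l \<le> ln (Z + real v * A) + real j * (ln A + ln (A + B))"
    and "l \<le> (2 * real j - 1) * ln B + ln (Z + real v * B) + ln (A + B)"
proof -
  have pos: "0 < Z" "0 < A" "0 < B" using assms(1) by (auto simp: admissible_def)
  have p: "0 < Z + real v * A" "0 < Z + real v * B" "0 < A + B"
    using pos by (auto intro: add_pos_nonneg)
  have N: "0 < real j * real v + 1" by (simp add: add_nonneg_pos)
  have l: "l \<le> ln x" if "(real j * real v + 1) powr b \<le> x" for x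
    using ln_mono[OF that] N by (simp add: l_def ln_powr)
  have "l \<le> ln ((Z + real v * A) * (Z * (Z + real v * B)) ^ j)"
    using assms(1) by (intro l) (simp add: admissible_def)
  then show "l \<le> ln (Z + real v * A) + real j * (ln Z + ln (Z + real v * B))"
    using pos p by (simp add: ln_mult ln_realpow)
  have "l \<le> ln ((Z + real v * A) * (A * (A + B)) ^ j)"
    using assms(1) by (intro l) (simp add: admissible_def)
  then show "l \<le> ln (Z + real v * A) + real j * (ln A + ln (A + B))"
    using pos p by (simp add: ln_mult ln_realpow)
  have "l \<le> ln (B ^ (2 * j - 1) * ((Z + real v * B) * (A + B)))"
    using assms(1) by (intro l) (simp add: admissible_def)
  then show "l \<le> (2 * real j - 1) * ln B + ln (Z + real v * B) + ln (A + B)"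
    using pos p assms(2) by (simp add: ln_mult ln_realpow of_nat_diff)
qed

section \<open>From local weights to the bound for \<open>E\<close>\<close>

lemma sum_if_eq_else:
  fixes x y :: real
  assumes "l \<in> {1..j}"
  shows "(\<Sum>i=1..j. if i = l then x else y) = x + (real j - 1) * y"
proof -
  have "(\<Sum>i=1..j. if i = l then x else y) = x + (\<Sum>i\<in>{1..j} - {l}. y)"
    using assms by (subst sum.remove[of _ l]) (auto intro!: sum.cong)
  then show ?thesis using assms by (simp add: of_nat_diff)
qed

lemma regular_set_bound:
  assumes n: "n \<ge> 1" and k: "k \<ge> 1" and j: "j \<ge> 1" and reg: "regular_map j k n U g"
    and adm: "\<And>v. v \<ge> 1 \<Longrightarrow> admissible j v ((2 * real j + 1) * \<delta>) (Z v) (A v) (B v)"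
  shows "real (card U) \<le> real k * real (kappa j n) powr (1 - \<delta>)"
proof -
  define P where "P = prime_factors n"
  define m where "m p = multiplicity p n" for p
  define N where "N p = real j * real (m p) + 1" for p
  \<comment> \<open>One shape covers all weights: \<open>(X, Y)\<close> is \<open>(X0, B)\<close>
    for \<open>d\<close> itself, \<open>(X1, A)\<close> for \<open>d(i := g d)\<close> and
    \<open>(Z, Y2)\<close> for \<open>d(i := d i * g d)\<close>.\<close>
  define wt where "wt X Y i p c =
      (if c = 0 then X (m p) else if c = i then Y (m p) else B (m p)) / N p"
    for X Y :: "nat \<Rightarrow> real" and i p c :: nat
  define R where "R X Y i e = (\<Prod>p\<in>P. wt X Y i p (slot j e p))"
    for X Y :: "nat \<Rightarrow> real" and i :: nat and e
  define X0 where "X0 v = Z v + real v * A v" for v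
  define X1 where "X1 v = Z v + real v * B v" for v
  define Y2 where "Y2 v = A v + B v" for v
  define q where "q = real (kappa j n) powr (- (1 - \<delta>))"
  have P: "finite P" "\<And>p. p \<in> P \<Longrightarrow> prime p" 
    by (auto simp: P_def)
  have m: "m p \<ge> 1" if "p \<in> P" for p
    using that by (simp add: P_def m_def prime_factors_multiplicity Suc_le_eq)
  have Npos: "N p > 0" for p by (simp add: N_def add_nonneg_pos)
  have ZAB: "Z v > 0" "A v > 0" "B v > 0" "X0 v > 0" "X1 v > 0" "Y2 v > 0"
    "X0 v + real j * real v * B v = real j * real v + 1" if "v \<ge> 1" for v
    using adm[OF that] by (auto simp: admissible_def X0_def X1_def Y2_def intro: add_pos_nonneg)
  have wt_pos: "wt X Y i p c > 0" if "X (m p) > 0" "Y (m p) > 0" "p \<in> P" for X Y i p c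
    using that Npos ZAB(3)[OF m] by (simp add: wt_def)
  have R_pos: "R X Y i e > 0" if "\<And>v. v \<ge> 1 \<Longrightarrow> X v > 0" "\<And>v. v \<ge> 1 \<Longrightarrow> Y v > 0" for X Y i e
    unfolding R_def using that wt_pos m by (intro prod_pos) blast
  \<comment> \<open>The hypothesis on \<open>X\<close> and \<open>Y\<close> says that the unscaled
    local total X + v (Y + (j - 1) B) equals X0 + j v B, which is \<open>N p\<close>.\<close>
  have R_sum: "(\<Sum>e\<in>coprime_tuples j n. R X Y i e) = 1"
    if i: "i \<in> {1..j}" and XY: "\<And>v. v \<ge> 1 \<Longrightarrow> X v + real v * (Y v - B v) = X0 v" for X Y i
  proof -
    have "wt X Y i p 0 + real (m p) * (\<Sum>l=1..j. wt X Y i p l) = 1" if p: "p \<in> P" for p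
    proof -
      have "(\<Sum>l=1..j. wt X Y i p l) = (\<Sum>l=1..j. if l = i then Y (m p) / N p else B (m p) / N p)"
        by (intro sum.cong) (auto simp: wt_def)
      also have "\<dots> = (Y (m p) + (real j - 1) * B (m p)) / N p"
        using i by (simp only: sum_if_eq_else) (simp add: add_divide_distrib)
      finally have "wt X Y i p 0 + real (m p) * (\<Sum>l=1..j. wt X Y i p l) =
          (X (m p) + real (m p) * (Y (m p) + (real j - 1) * B (m p))) / N p"
        by (simp add: wt_def add_divide_distrib distrib_left)
      also have "X (m p) + real (m p) * (Y (m p) + (real j - 1) * B (m p)) = N p"
        using XY[OF m[OF p]] ZAB(7)[OF m[OF p]] by (simp add: N_def algebra_simps)
      finally show ?thesis using Npos[of p] by simp
    qed
    then show ?thesis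
      using sum_coprime_tuples[OF n, where j = j and a = "wt X Y i"]
      by (simp add: R_def P_def m_def)
  qed
  have kap: "real (kappa j n) = (\<Prod>p\<in>P. N p)"
    using kappa_eq_prod[OF n] by (simp add: P_def N_def m_def add.commute)
  have kpos: "real (kappa j n) > 0" unfolding kap by (intro prod_pos) (auto simp: Npos)
  have q: "q > 0" "ln q = - (1 - \<delta>) * (\<Sum>p\<in>P. ln (N p))"
  proof -
    show "q > 0" using kpos by (simp add: q_def)
    have "ln (real (kappa j n)) = (\<Sum>p\<in>P. ln (N p))"
      unfolding kap by (intro ln_prod P(1) less_imp_neq[OF Npos, symmetric])
    then show "ln q = - (1 - \<delta>) * (\<Sum>p\<in>P. ln (N p))" using kpos by (simp add: q_def ln_powr)
  qed
  have U: "U \<subseteq> coprime_tuples j n"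
    using reg by (auto simp: regular_map_def regular_set_def coprime_tuples_def)
  have finU: "finite U" using U finite_coprime_tuples[OF n] finite_subset by blast
  \<comment> \<open>With \<open>Y = B\<close> the weight of \<open>d\<close> itself is the same for
    every \<open>i\<close>; the index 1 is chosen as a member of \<open>{1..j}\<close>.\<close>
  have local: "ln (wt X0 B 1 p (slot j d p)) + (\<Sum>i=1..j. ln (wt X1 A i p (slot j (d(i := g d)) p))
        + ln (wt Z Y2 i p (slot j (d(i := d i * g d)) p))) \<ge> (2 * real j + 1) * (- (1 - \<delta>)) * ln (N p)"
    if d: "d \<in> U" and p: "p \<in> P" for d p
  proof -
    have cop: "coprime_tuple j d" "\<And>i. i \<in> {1..j} \<Longrightarrow> coprime_tuple j (d(i := g d))"
      "\<And>i. i \<in> {1..j} \<Longrightarrow> coprime_tuple j (d(i := d i * g d))"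
      using U d regular_map_update_in[OF reg _ d] by (auto simp: coprime_tuples_def)
    have g: "\<And>i. i \<in> {1..j} \<Longrightarrow> coprime (g d) (d i)" using reg d by (auto simp: regular_map_def)
    have pr: "prime p" using P p by blast
    note pos = ZAB(1-6)[OF m[OF p]]
    note slot = slot_eq[OF _ pr]
    note adl = admissible_ln[OF adm[OF m[OF p]] j, folded N_def X0_def X1_def Y2_def]
    have lnw: "ln (x / N p) = ln x - ln (N p)" if "x > 0" for x
      using that Npos[of p] by (simp add: ln_div)
    consider "p dvd g d" | "\<not> p dvd g d" "\<And>i. i \<in> {1..j} \<Longrightarrow> \<not> p dvd d i"
      | l where "l \<in> {1..j}" "p dvd d l" by blast
    then show ?thesis
    proof cases
      case 1
      have nd: "\<not> p dvd d i" if "i \<in> {1..j}" for i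
        using g[OF that] 1 pr by (meson coprime_common_divisor not_prime_unit)
      have "slot j d p = 0" by (rule slot_eq_0) (use nd in auto)
      moreover have "slot j (d(i := g d)) p = i" "slot j (d(i := d i * g d)) p = i"
        if "i \<in> {1..j}" for i
        using that 1 cop by (auto intro!: slot)
      ultimately have "ln (wt X0 B 1 p (slot j d p)) + (\<Sum>i=1..j. ln (wt X1 A i p (slot j (d(i := g d)) p))
        + ln (wt Z Y2 i p (slot j (d(i := d i * g d)) p))) =
        ln (X0 (m p) / N p) + (\<Sum>i=1..j. ln (A (m p) / N p) + ln (Y2 (m p) / N p))"
        by (intro arg_cong2[where f = "(+)"] sum.cong) (auto simp: wt_def)
      then show ?thesis using adl(2) pos by (simp add: lnw algebra_simps)
    next
      case 2
      have "slot j d p = 0" by (rule slot_eq_0) (use 2 in auto)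
      moreover have "slot j (d(i := g d)) p = 0" "slot j (d(i := d i * g d)) p = 0"
        if "i \<in> {1..j}" for i
        using that 2 pr by (auto intro!: slot_eq_0 simp: prime_dvd_mult_iff split: if_splits)
      ultimately have "ln (wt X0 B 1 p (slot j d p)) + (\<Sum>i=1..j. ln (wt X1 A i p (slot j (d(i := g d)) p))
        + ln (wt Z Y2 i p (slot j (d(i := d i * g d)) p))) =
        ln (X0 (m p) / N p) + (\<Sum>i=1..j. ln (X1 (m p) / N p) + ln (Z (m p) / N p))"
        by (intro arg_cong2[where f = "(+)"] sum.cong) (auto simp: wt_def)
      then show ?thesis using adl(1) pos by (simp add: lnw algebra_simps)
    next
      case (3 l)
      have l0: "l \<noteq> 0" using 3 by auto
      have ng: "\<not> p dvd g d"
        using g[OF 3(1)] 3 pr by (meson coprime_common_divisor not_prime_unit)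
      have nd: "\<not> p dvd d i" if "i \<in> {1..j}" "i \<noteq> l" for i
        using slot[OF cop(1) that(1)] slot[OF cop(1) 3] that(2) by auto
      have "slot j d p = l" using slot[OF cop(1) 3] .
      \<comment> \<open>Only replacing entry \<open>l\<close> itself removes \<open>p\<close> from
        the tuple. Hence \<open>B\<close> occurs once for \<open>d\<close> and twice for each
        \<open>i\<close> other than \<open>l\<close>, which explains the exponent
        \<open>2 * j - 1\<close> in \<open>admissible\<close>.\<close>
      moreover have "slot j (d(i := g d)) p = (if i = l then 0 else l)" if "i \<in> {1..j}" for i
      proof (cases "i = l")
        case True
        then show ?thesis using ng nd by (auto intro!: slot_eq_0 split: if_splits)
      next
        case False
        then show ?thesis using 3 cop(2)[OF that] by (auto intro!: slot)
      qed
      moreover have "slot j (d(i := d i * g d)) p = l" if "i \<in> {1..j}" for i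
        using 3 cop(3)[OF that] by (auto intro!: slot)
      ultimately have "ln (wt X0 B 1 p (slot j d p)) + (\<Sum>i=1..j. ln (wt X1 A i p (slot j (d(i := g d)) p))
        + ln (wt Z Y2 i p (slot j (d(i := d i * g d)) p))) =
        ln (B (m p) / N p) + (\<Sum>i=1..j. if i = l then ln (X1 (m p) / N p) + ln (Y2 (m p) / N p)
          else ln (B (m p) / N p) + ln (B (m p) / N p))"
        using l0 by (intro arg_cong2[where f = "(+)"] sum.cong) (auto simp: wt_def)
      also have "\<dots> = ln (B (m p) / N p) + (ln (X1 (m p) / N p) + ln (Y2 (m p) / N p)
          + (real j - 1) * (ln (B (m p) / N p) + ln (B (m p) / N p)))"
        using 3 by (simp only: sum_if_eq_else)
      finally show ?thesis using adl(3) pos by (simp add: lnw algebra_simps)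
    qed
  qed
  text \<open>The inequality between the arithmetic and geometric means of \<open>2j + 1\<close> numbers, in the form
    \<open>x \<ge> q (1 + ln x - ln q)\<close> for each of them.\<close>
  have tangent: "x \<ge> q * (1 + ln x - ln q)" if "x > 0" for x
  proof -
    have "ln (x / q) \<le> x / q - 1" using that q by (intro ln_le_minus_one) simp
    then have "q * (1 + ln x - ln q) \<le> q * (x / q)"
      using that q(1) by (intro mult_left_mono) (auto simp: ln_div)
    then show ?thesis using q(1) by simp
  qed
  \<comment> \<open>\<open>tangent\<close> is summed over the 2 j + 1 images. The sum of the
    logarithms is at least (2 j + 1) ln q by \<open>local\<close> summed over the primes, so the
    logarithms drop out.\<close>
  have ptw: "(2 * real j + 1) * q \<le> R X0 B 1 d +
      (\<Sum>i=1..j. R X1 A i (d(i := g d)) + R Z Y2 i (d(i := d i * g d)))" if d: "d \<in> U" for d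
  proof -
    let ?a = "ln (R X0 B 1 d)" and ?b = "\<lambda>i. ln (R X1 A i (d(i := g d)))"
      and ?c = "\<lambda>i. ln (R Z Y2 i (d(i := d i * g d)))"
    have lnR: "ln (R X Y i e) = (\<Sum>p\<in>P. ln (wt X Y i p (slot j e p)))"
      if "\<And>v. v \<ge> 1 \<Longrightarrow> X v > 0" "\<And>v. v \<ge> 1 \<Longrightarrow> Y v > 0" for X Y i e
      unfolding R_def
      by (intro ln_prod P(1) less_imp_neq[THEN not_sym] wt_pos that m)
    have "?a + (\<Sum>i=1..j. ?b i + ?c i) = (\<Sum>p\<in>P. ln (wt X0 B 1 p (slot j d p)) +
        (\<Sum>i=1..j. ln (wt X1 A i p (slot j (d(i := g d)) p))
        + ln (wt Z Y2 i p (slot j (d(i := d i * g d)) p))))"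
      using ZAB by (simp add: lnR sum.distrib sum.swap[of _ P])
    also have "\<dots> \<ge> (\<Sum>p\<in>P. (2 * real j + 1) * (- (1 - \<delta>)) * ln (N p))"
      by (intro sum_mono local d)
    finally have L: "?a + (\<Sum>i=1..j. ?b i + ?c i) \<ge> (2 * real j + 1) * ln q"
      unfolding q(2) by (simp only: sum_distrib_left mult.assoc)
    have "(2 * real j + 1) * q \<le>
        q * ((2 * real j + 1) * (1 - ln q) + (?a + (\<Sum>i=1..j. ?b i + ?c i)))"
    proof -
      have "q * (2 * real j + 1) \<le> q * ((2 * real j + 1) * (1 - ln q) + (?a + (\<Sum>i=1..j. ?b i + ?c i)))"
        using L q(1) by (intro mult_left_mono) (auto simp: algebra_simps)
      then show ?thesis by (simp add: mult.commute)
    qed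
    also have "\<dots> = q * (1 + ?a - ln q) + (\<Sum>i=1..j. q * (1 + ?b i - ln q) + q * (1 + ?c i - ln q))"
      by (simp add: sum.distrib sum_subtractf sum_distrib_left[symmetric] algebra_simps)
    also have "\<dots> \<le> R X0 B 1 d + (\<Sum>i=1..j. R X1 A i (d(i := g d)) + R Z Y2 i (d(i := d i * g d)))"
      using ZAB by (intro add_mono sum_mono tangent R_pos) auto
    finally show ?thesis .
  qed
  \<comment> \<open>Here the map is the identity, so the sum is at most the total mass 1, and 1 is
    at most \<open>k\<close>.\<close>
  have S0: "(\<Sum>d\<in>U. R X0 B 1 d) \<le> real k"
  proof -
    have "(\<Sum>d\<in>U. R X0 B 1 d) \<le> (\<Sum>d\<in>coprime_tuples j n. R X0 B 1 d)"
      using U finite_coprime_tuples[OF n] ZAB by (intro sum_mono2 less_imp_le[OF R_pos]) auto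
    also have "\<dots> = 1" using j by (intro R_sum) auto
    finally show ?thesis using k by simp
  qed
  have fib: "(\<Sum>d\<in>U. R X Y i (f d)) \<le> real k"
    if "i \<in> {1..j}" "\<And>v. v \<ge> 1 \<Longrightarrow> X v > 0" "\<And>v. v \<ge> 1 \<Longrightarrow> Y v > 0"
      "\<And>v. v \<ge> 1 \<Longrightarrow> X v + real v * (Y v - B v) = X0 v"
      "\<And>d. d \<in> U \<Longrightarrow> f d \<in> coprime_tuples j n"
      "\<And>e. e \<in> coprime_tuples j n \<Longrightarrow> card {d \<in> U. f d = e} \<le> k" for X Y i f
  proof -
    have "(\<Sum>d\<in>U. R X Y i (f d)) \<le> real k * (\<Sum>e\<in>coprime_tuples j n. R X Y i e)"
      using that finU finite_coprime_tuples[OF n]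
      by (intro sum_compose_le less_imp_le[OF R_pos]) auto
    then show ?thesis using R_sum that by simp
  qed
  have S1: "(\<Sum>d\<in>U. R X1 A i (d(i := g d))) \<le> real k"
    and S2: "(\<Sum>d\<in>U. R Z Y2 i (d(i := d i * g d))) \<le> real k" if i: "i \<in> {1..j}" for i
    using i ZAB regular_map_update_in[OF reg i] regular_map_fibre_le[OF n reg i]
    by (intro fib; auto simp: X0_def X1_def Y2_def coprime_tuples_def algebra_simps)+
  have "real (card U) * ((2 * real j + 1) * q) = (\<Sum>d\<in>U. (2 * real j + 1) * q)" by simp
  also have "\<dots> \<le> (\<Sum>d\<in>U. R X0 B 1 d +
      (\<Sum>i=1..j. R X1 A i (d(i := g d)) + R Z Y2 i (d(i := d i * g d))))"
    by (intro sum_mono ptw)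
  also have "\<dots> = (\<Sum>d\<in>U. R X0 B 1 d) + (\<Sum>i=1..j. (\<Sum>d\<in>U. R X1 A i (d(i := g d)))
      + (\<Sum>d\<in>U. R Z Y2 i (d(i := d i * g d))))"
    by (simp add: sum.distrib sum.swap[of _ U])
  also have "\<dots> \<le> real k + (\<Sum>i=1..j. real k + real k)"
    by (intro add_mono sum_mono S0 S1 S2)
  also have "\<dots> = (2 * real j + 1) * real k" by (simp add: algebra_simps)
  finally have "(2 * real j + 1) * (real (card U) * q) \<le> (2 * real j + 1) * real k"
    by (simp add: mult_ac)
  then have le: "real (card U) * q \<le> real k" by (subst (asm) mult_le_cancel_left_pos) auto
  have "q * real (kappa j n) powr (1 - \<delta>) = 1"
    using kpos by (simp add: q_def powr_add[symmetric])
  then have "real (card U) = real (card U) * q * real (kappa j n) powr (1 - \<delta>)"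
    by (simp add: mult.assoc)
  also have "\<dots> \<le> real k * real (kappa j n) powr (1 - \<delta>)"
    using le by (intro mult_right_mono) auto
  finally show ?thesis .
qed

lemma E_bound:
  assumes "n \<ge> 1" "k \<ge> 1" "j \<ge> 1"
    and "\<And>v. v \<ge> 1 \<Longrightarrow> \<exists>Z A B. admissible j v ((2 * real j + 1) * \<delta>) Z A B"
  shows "real (E j k n) \<le> real k * real (kappa j n) powr (1 - \<delta>)"
proof -
  obtain Z A B where
    adm: "\<And>v. v \<ge> 1 \<Longrightarrow> admissible j v ((2 * real j + 1) * \<delta>) (Z v) (A v) (B v)"
    using assms(4) by metis
  have "E j k n \<in> {card U | U. \<exists>g. regular_map j k n U g}"
    unfolding E_def using regular_map_sizes_finite[OF assms(1)] regular_map_sizes_nonempty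
    by (rule Max_in)
  then obtain U g where "E j k n = card U" "regular_map j k n U g" by auto
  then show ?thesis using regular_set_bound[OF assms(1-3) _ adm] by simp
qed

section \<open>Bounds for the exponents\<close>

text \<open>Rounding the exponent up to a fraction reduces a real power to an inequality between
  integer powers.\<close>

lemma powr_le_if_power_le:
  fixes t s b :: real
  assumes "t \<ge> 1" "s > 0" "m > 0" "b \<le> real a / real m" "t ^ a \<le> s ^ m"
  shows "t powr b \<le> s"
proof -
  have "t powr b \<le> t powr (real a / real m)" using assms by (intro powr_mono) auto
  also have "\<dots> = (t ^ a) powr (1 / real m)"
    using assms(1) by (simp add: powr_powr flip: powr_realpow)
  also have "\<dots> \<le> (s ^ m) powr (1 / real m)"
    using assms by (intro powr_mono2) auto
  also have "\<dots> = s" using assms by (simp add: powr_powr flip: powr_realpow)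
  finally show ?thesis .
qed

text \<open>A Pade bound: the difference vanishes at 0 and has a nonnegative derivative.\<close>

lemma ln_one_plus_ge:
  fixes x :: real
  assumes "x \<ge> 0"
  shows "2 * x / (2 + x) \<le> ln (1 + x)"
proof -
  have "(\<lambda>x. ln (1 + x) - 2 * x / (2 + x)) 0 \<le> (\<lambda>x. ln (1 + x) - 2 * x / (2 + x)) x"
  proof (rule DERIV_nonneg_imp_nondecreasing[OF assms])
    fix y :: real assume y: "0 \<le> y" "y \<le> x"
    have "((\<lambda>x. ln (1 + x) - 2 * x / (2 + x)) has_real_derivative
        1 / (1 + y) - (2 * (2 + y) - 2 * y) / ((2 + y) * (2 + y))) (at y)"
      using y by (auto intro!: derivative_eq_intros)
    moreover have "1 / (1 + y) - (2 * (2 + y) - 2 * y) / ((2 + y) * (2 + y)) = y\<^sup>2 / ((1 + y) * (2 + y)\<^sup>2)"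
      using y by (simp add: divide_simps) (simp add: algebra_simps power2_eq_square)
    ultimately show "\<exists>z. ((\<lambda>x. ln (1 + x) - 2 * x / (2 + x)) has_real_derivative z) (at y) \<and> 0 \<le> z"
      using y by (intro exI[of _ "y\<^sup>2 / ((1 + y) * (2 + y)\<^sup>2)"]) auto
  qed
  then show ?thesis by simp
qed

text \<open>Bounds \<open>B ^ (2 * j - 1)\<close> for B = 1 - c / j uniformly in \<open>j\<close>.
  With (2 j - 1) z = 2 c it suffices that exp (-z) is at most 1 - c / j; the assumed upper bound on
  \<open>c\<close> is exactly z j \<le> 1.\<close>

lemma exp_le_one_minus_power:
  fixes c :: real
  assumes "j \<ge> 1" "0 \<le> c" "c \<le> 1 - 1 / (2 * real j)"
  shows "exp (- (2 * c)) \<le> (1 - c / real j) ^ (2 * j - 1)"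
proof -
  define z where "z = 2 * c / (2 * real j - 1)"
  have j: "real j \<ge> 1" using assms(1) by simp
  have z0: "z \<ge> 0" using j assms by (simp add: z_def)
  have zj: "z * real j \<le> 1"
    using j assms(3) by (simp add: z_def field_simps)
  have cz: "c / real j = z - z / (2 * real j)"
    using j by (simp add: z_def divide_simps) (simp add: algebra_simps)
  have "1 \<le> (1 - c / real j) * (1 + z + z\<^sup>2 / 2)"
  proof -
    have "(1 - c / real j) * (1 + z + z\<^sup>2 / 2) - 1
        = z * ((1 - z * real j) * (1 + z) + z\<^sup>2 / 2) / (2 * real j)"
      unfolding cz using j by (simp add: divide_simps) (simp add: algebra_simps power2_eq_square)
    also have "\<dots> \<ge> 0" using z0 zj j by (intro divide_nonneg_nonneg mult_nonneg_nonneg add_nonneg_nonneg) auto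
    finally show ?thesis by simp
  qed
  also have "\<dots> \<le> (1 - c / real j) * exp z"
  proof (intro mult_left_mono exp_lower_Taylor_quadratic z0)
    have "c \<le> real j" using assms(3) j by (smt (verit) divide_nonneg_nonneg)
    then show "0 \<le> 1 - c / real j" using j by simp
  qed
  finally have "exp (- z) \<le> 1 - c / real j" by (simp add: exp_minus field_simps)
  then have "exp (- z) ^ (2 * j - 1) \<le> (1 - c / real j) ^ (2 * j - 1)"
    by (intro power_mono) auto
  moreover have "real (2 * j - 1) * (- z) = - (2 * c)"
    using j assms(1) by (simp add: z_def of_nat_diff field_simps)
  ultimately show ?thesis by (simp only: exp_of_nat_mult[symmetric])
qed

text \<open>Certifies a numerical lower bound for an exponential by rational arithmetic; splitting
  the exponent into \<open>m\<close> steps sharpens the quadratic estimate.\<close>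

lemma exp_minus_ge:
  fixes s x :: real
  assumes "0 \<le> x" "x \<le> 1" "0 \<le> s" "(1 + x + x\<^sup>2) ^ m * s \<le> 1"
  shows "s \<le> exp (- (real m * x))"
proof -
  have "exp (real m * x) * s \<le> (1 + x + x\<^sup>2) ^ m * s"
    unfolding exp_of_nat_mult using assms
    by (intro mult_right_mono power_mono exp_bound) auto
  then have "exp (real m * x) * s \<le> 1" using assms(4) by linarith
  then show ?thesis by (simp add: exp_minus field_simps)
qed

section \<open>Estimates of \<open>delta\<close>\<close>

lemma delta_1: "(2 * real 1 + 1) * delta 1 = ln (32 / 27) / ln 2"
proof -
  have "ln (32 / 27 :: real) = ln ((2 / 3) * (4 / 3)\<^sup>2)" by (simp add: power2_eq_square)
  also have "\<dots> = ln (2 / 3) + 2 * ln (4 / 3)" by (subst ln_mult) (auto simp: ln_realpow)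
  finally show ?thesis by (simp add: delta_def field_simps)
qed

text \<open>With this, part (b) implies the case j = 2 of part (a). The computation even gives
  0.04.\<close>

lemma delta_2_le: "delta 2 \<le> 0.045072"
proof -
  have "5 * (8 * ln (4 / 5) + 7 * ln (7 / 5)) = ln (((4 / 5) ^ 8 * (7 / 5) ^ 7) ^ 5 :: real)"
    by (simp only: ln_realpow ln_mult zero_less_power zero_less_divide_iff zero_less_numeral
        mult_pos_pos) simp
  also have "\<dots> \<le> ln (3 ^ 3)" by (intro ln_mono) (auto simp: field_simps)
  also have "\<dots> = 3 * ln 3" by (subst ln_realpow) auto
  finally have *: "8 * ln (4 / 5) + 7 * ln (7 / 5) \<le> 3 / 5 * ln (3::real)" by simp
  have "delta 2 = (8 * ln (4 / 5) + 7 * ln (7 / 5)) / (15 * ln 3)"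
    by (simp add: delta_def field_simps)
  also have "\<dots> \<le> (3 / 5 * ln 3) / (15 * ln 3)" using * by (intro divide_right_mono) auto
  finally show ?thesis by simp
qed

lemma ln_three_halves_le: "ln (3 / 2) \<le> (407 / 1000 :: real)"
proof -
  have "(3 / 2 :: real) \<le> (1 + 407/4000 + (407/4000)\<^sup>2 / 2) ^ 4"
    by (simp add: power2_eq_square power4_eq_xxxx)
  also have "\<dots> \<le> exp (407/4000) ^ 4"
    by (intro power_mono exp_lower_Taylor_quadratic) auto
  also have "\<dots> = exp (407 / 1000)" by (simp flip: exp_of_nat_mult)
  finally have "ln (3 / 2) \<le> ln (exp (407 / 1000 :: real))" by (intro ln_mono) auto
  then show ?thesis by simp
qed

text \<open>The simpler exponent turns \<open>j + 1\<close> into 5/4. As \<open>j\<close> grows, the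
  left side times ln (j + 1) tends to 3 ln (3/2) - 1, about 0.216, while ln (5/4) is about
  0.223.\<close>

lemma delta_le:
  assumes "j \<ge> 3"
  shows "(2 * real j + 1) * delta j \<le> ln (5 / 4) / ln (real j + 1)"
proof -
  define x where "x = real j"
  have x: "x \<ge> 3" using assms by (simp add: x_def)
  have "ln (2 * x / (2 * x + 1)) = - ln (1 + 1 / (2 * x))"
    using x by (simp add: field_simps flip: ln_inverse)
  also have "\<dots> \<le> - (2 * (1 / (2 * x)) / (2 + 1 / (2 * x)))"
    using ln_one_plus_ge[of "1 / (2 * x)"] x by simp
  also have "\<dots> = - (2 / (4 * x + 1))" using x by (simp add: field_simps)
  finally have 1: "ln (2 * x / (2 * x + 1)) \<le> - (2 / (4 * x + 1))" .
  have "ln ((3 * x + 1) / (2 * x + 1)) = ln (3 / 2 * (1 - 1 / (6 * x + 3)))"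
    using x by (intro arg_cong[where f = ln]) (simp add: divide_simps, simp add: algebra_simps)
  also have "\<dots> = ln (3 / 2) + ln (1 - 1 / (6 * x + 3))"
    using x by (subst ln_mult) (auto simp: field_simps)
  also have "\<dots> \<le> 407 / 1000 - 1 / (6 * x + 3)"
  proof -
    have "0 < 1 - 1 / (6 * x + 3)" using x by (simp add: field_simps)
    from ln_le_minus_one[OF this] show ?thesis using ln_three_halves_le by linarith
  qed
  finally have 2: "ln ((3 * x + 1) / (2 * x + 1)) \<le> 407 / 1000 - 1 / (6 * x + 3)" .
  have "2 * x\<^sup>2 * ln (2 * x / (2 * x + 1)) + (3 * x + 1) * ln ((3 * x + 1) / (2 * x + 1))
      \<le> 2 * x\<^sup>2 * (- (2 / (4 * x + 1))) + (3 * x + 1) * (407 / 1000 - 1 / (6 * x + 3))"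
    using x by (intro add_mono mult_left_mono 1 2) auto
  also have "\<dots> = (3 * x + 1) * (407 / 1000) - 4 * x\<^sup>2 / (4 * x + 1) - (3 * x + 1) / (6 * x + 3)"
    by (simp add: algebra_simps)
  also have "\<dots> \<le> (3 * x + 1) * (407 / 1000) - (x - 1 / 4) - 10 / 21"
  proof (intro diff_mono order.refl)
    show "x - 1 / 4 \<le> 4 * x\<^sup>2 / (4 * x + 1)" using x by (simp add: field_simps power2_eq_square)
    show "10 / 21 \<le> (3 * x + 1) / (6 * x + 3)" using x by (simp add: field_simps)
  qed
  \<comment> \<open>The slope on the left is 3 * 0.407 - 1 = 0.221, just below 2/9, which is the
    Pade bound for ln (5/4).\<close>
  also have "\<dots> \<le> (x + 1) * (2 / 9)" using x by (simp add: field_simps)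
  also have "\<dots> \<le> (x + 1) * ln (5 / 4)"
    using x ln_one_plus_ge[of "1 / 4"] by (intro mult_left_mono) auto
  finally have main: "2 * x\<^sup>2 * ln (2 * x / (2 * x + 1)) + (3 * x + 1) * ln ((3 * x + 1) / (2 * x + 1))
      \<le> (x + 1) * ln (5 / 4)" .
  have "(2 * x + 1) * delta j = (2 * x\<^sup>2 * ln (2 * x / (2 * x + 1))
      + (3 * x + 1) * ln ((3 * x + 1) / (2 * x + 1))) / (x + 1) / ln (x + 1)"
  proof -
    have "(2 * x + 1) * (2 * x\<^sup>2 / ((x + 1) * (2 * x + 1)) * p + (3 * x + 1) / ((x + 1) * (2 * x + 1)) * q)
        = (2 * x\<^sup>2 * p + (3 * x + 1) * q) / (x + 1)" for p q
      using x by (simp add: divide_simps)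
    then show ?thesis unfolding delta_def x_def[symmetric] by (simp only: times_divide_eq_right)
  qed
  also have "\<dots> \<le> ln (5 / 4) / ln (x + 1)"
    using main x by (intro divide_right_mono) (auto simp: field_simps)
  finally show ?thesis by (simp add: x_def)
qed

text \<open>Since j v + 1 is at most (j + 1) v, the power is at most 5/4 times a power of
  \<open>v\<close>. Its exponent is at most 1/6 because (5/4)^6 < 4, and the sixth root of
  \<open>v\<close> lies below a line.\<close>

lemma powr_delta_le:
  assumes "j \<ge> 3" "v \<ge> 1"
  shows "(real j * real v + 1) powr ((2 * real j + 1) * delta j) \<le> 5 / 4 * (1 + real v / 14)"
    and "v = 1 \<Longrightarrow> (real j * real v + 1) powr ((2 * real j + 1) * delta j) \<le> 5 / 4"
proof -
  define b where "b = ln (5 / 4) / ln (real j + 1)"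
  have lnj: "ln (real j + 1) > 0" using assms by simp
  have b0: "b \<ge> 0" using assms by (simp add: b_def)
  have "6 * ln (5 / 4) = ln ((5 / 4 :: real) ^ 6)" by (simp add: ln_realpow)
  also have "\<dots> \<le> ln (real j + 1)" using assms by (intro ln_mono) (auto simp: field_simps)
  finally have b6: "b \<le> real 1 / real 6" using lnj by (simp add: b_def field_simps)
  have "(real j * real v + 1) powr ((2 * real j + 1) * delta j) \<le> (real j * real v + 1) powr b"
    using delta_le[OF assms(1)] by (intro powr_mono) (auto simp: b_def)
  also have "\<dots> \<le> ((real j + 1) * real v) powr b"
    using assms b0 by (intro powr_mono2) (auto simp: algebra_simps)
  also have "\<dots> = 5 / 4 * real v powr b"
    using lnj by (simp add: powr_mult) (simp add: powr_def b_def)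
  finally have *: "(real j * real v + 1) powr ((2 * real j + 1) * delta j) \<le> 5 / 4 * real v powr b" .
  have "real v powr b \<le> 1 + real v / 14"
  proof (rule powr_le_if_power_le[OF _ _ _ b6])
    define y where "y = real v / 14"
    have y: "y \<ge> 0" by (simp add: y_def)
    \<comment> \<open>20 y^3 is compared with its tangent at 1/5; the square is then completed with
      15 y^2 and the remaining -5.6 y.\<close>
    have "(1 + y) ^ 6 - 14 * y = 20 * (y - 1/5)\<^sup>2 * (y + 2/5) + 15 * (y - 14/75)\<^sup>2
        + (68/100 - 15 * (14/75)\<^sup>2) + 15 * y ^ 4 + 6 * y ^ 5 + y ^ 6"
      by (simp add: power2_eq_square eval_nat_numeral algebra_simps)
    also have "\<dots> \<ge> 0"
      using y by (intro add_nonneg_nonneg mult_nonneg_nonneg) (auto simp: power2_eq_square)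
    finally show "real v ^ 1 \<le> (1 + real v / 14) ^ 6" by (simp add: y_def)
  qed (use assms in \<open>auto intro: add_pos_nonneg\<close>)
  then show "(real j * real v + 1) powr ((2 * real j + 1) * delta j) \<le> 5 / 4 * (1 + real v / 14)"
    using * by simp
  show "v = 1 \<Longrightarrow> (real j * real v + 1) powr ((2 * real j + 1) * delta j) \<le> 5 / 4"
    using * by simp
qed

section \<open>Admissible weights\<close>

text \<open>The rational inequalities \<open>s \<le> \<dots>\<close> for \<open>v \<ge> 2\<close> are tight near \<open>v = 2\<close>, but as polynomials in
  \<open>t = v - 2\<close> (after clearing denominators) all their coefficients are positive.\<close>

lemma admissible_1:
  assumes "v \<ge> 1"
  shows "\<exists>Z A B. admissible 1 v ((2 * real 1 + 1) * delta 1) Z A B"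
proof (cases "v = 1")
  case True
  \<comment> \<open>With all parameters 2/3, each of the three products equals 32/27
    exactly.\<close>
  have "2 powr ((2 * real 1 + 1) * delta 1) = (32 / 27 :: real)"
    unfolding delta_1 by (simp add: powr_def)
  then have "admissible 1 v ((2 * real 1 + 1) * delta 1) (2/3) (2/3) (2/3)"
    using True by (simp add: admissible_def)
  then show ?thesis by blast
next
  case False
  define x where "x = real v"
  define t where "t = x - 2"
  \<comment> \<open>\<open>s\<close> is a linear upper bound for the fourth root of x + 1.
    \<open>Z\<close> is fixed at 1/2 and the normalisation then determines \<open>A = B\<close>,
    which makes the second and third products equal.\<close>
  define s where "s = (x + 10) / 9"
  define A where "A = (2 * x + 1) / (4 * x)"
  have t: "t \<ge> 0" "x = t + 2" using assms False by (auto simp: t_def x_def)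
  have x: "x \<ge> 2" using t by simp
  have xA: "x * A = (2 * x + 1) / 4" using x by (simp add: A_def)
  have A0: "A \<ge> 1 / 2" using x by (simp add: A_def field_simps)
  have "4 * ln (32 / 27) = ln ((32 / 27 :: real) ^ 4)" by (subst ln_realpow) auto
  also have "\<dots> \<le> ln 2" by (intro ln_mono) (auto simp: field_simps)
  finally have d: "(2 * real 1 + 1) * delta 1 \<le> real 1 / real 4"
    unfolding delta_1 by (simp add: field_simps)
  have N: "(x + 1) powr ((2 * real 1 + 1) * delta 1) \<le> s"
  proof (rule powr_le_if_power_le[OF _ _ _ d])
    have "6561 * (s ^ 4 - (x + 1)) = t ^ 4 + 48 * t ^ 3 + 864 * t\<^sup>2 + 351 * t + 1053"
      unfolding s_def t(2) by (simp add: field_simps eval_nat_numeral)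
    also have "\<dots> \<ge> 0" using t by simp
    finally show "(x + 1) ^ 1 \<le> s ^ 4" by simp
  qed (use x in \<open>auto simp: s_def\<close>)
  have s1: "s \<le> (1 / 2 + x * A) * (A * (2 * A))"
  proof -
    have "72 * x\<^sup>2 * ((1 / 2 + x * A) * (A * (2 * A)) - s)
        = 2 * (5 * t ^ 3 + 25 / 2 * t\<^sup>2 + 23 / 4 * t + 39 / 8)"
      unfolding xA s_def using x
      by (simp add: A_def divide_simps) (simp add: t eval_nat_numeral algebra_simps)
    also have "\<dots> \<ge> 0" using t by simp
    finally show ?thesis using x by (simp add: zero_le_mult_iff)
  qed
  have s0: "(1 / 2 + x * A) * (A * (2 * A)) \<le> (1 / 2 + x * A) * (1 / 2 * (1 / 2 + x * A))"
  proof (intro mult_left_mono)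
    have "A * (2 * A) \<le> 5 / 8 * (2 * (5 / 8))"
      using A0 x by (intro mult_mono) (auto simp: A_def field_simps)
    also have "\<dots> \<le> 1 / 2 * (1 / 2 + x * A)" unfolding xA using x by simp
    finally show "A * (2 * A) \<le> 1 / 2 * (1 / 2 + x * A)" .
  qed (use x A0 in auto)
  have "x * A + x * A = x + 1 / 2" unfolding xA by (simp add: field_simps)
  then have "admissible 1 v ((2 * real 1 + 1) * delta 1) (1 / 2) A A"
    using order.trans[OF N order.trans[OF s1 s0]] order.trans[OF N s1] A0
    unfolding admissible_def x_def[symmetric] by (simp add: mult.left_commute)
  then show ?thesis by blast
qed

lemma admissible_2:
  assumes "v \<ge> 1"
  shows "\<exists>Z A B. admissible 2 v ((2 * real 2 + 1) * 0.045072) Z A B"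
proof (cases "v = 1")
  case True
  \<comment> \<open>125/96 is the third product for the parameters below; the other two are 4/3. The
    exponent 0.22536 is rounded up to 3/13.\<close>
  have "3 powr ((2 * real 2 + 1) * 0.045072) \<le> (125 / 96 :: real)"
    by (rule powr_le_if_power_le[of _ _ 13 _ 3]) (auto simp: power_divide)
  then have "admissible 2 v ((2 * real 2 + 1) * 0.045072) (2/3) (2/3) (5/6)"
    using True by (simp add: admissible_def power2_eq_square power3_eq_cube)
  then show ?thesis by blast
next
  case False
  define x where "x = real v"
  define t where "t = x - 2"
  \<comment> \<open>\<open>s\<close> is a linear upper bound for the fourth root of 2 x + 1.
    \<open>B\<close> is forced by the normalisation once Z = 9/20 and A = 13/20.\<close>
  define s where "s = 6 / 5 + 3 * x / 20"
  define B where "B = (27 * x + 11) / (40 * x)"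
  have t: "t \<ge> 0" "x = t + 2" using assms False by (auto simp: t_def x_def)
  have x: "x \<ge> 2" using t by simp
  have xB: "x * B = (27 * x + 11) / 40" using x by (simp add: B_def)
  have B0: "B > 0" using x by (simp add: B_def)
  have N: "(2 * x + 1) powr ((2 * real 2 + 1) * 0.045072) \<le> s"
  proof (rule powr_le_if_power_le[where a = 1 and m = 4])
    have "s ^ 4 - (2 * x + 1) = 1/16 + 1/40 * t + 243/800 * t ^ 2 + 81/4000 * t ^ 3 + 81/160000 * t ^ 4"
      unfolding s_def t(2) by (simp add: field_simps eval_nat_numeral)
    also have "\<dots> \<ge> 0" using t by simp
    finally show "(2 * x + 1) ^ 1 \<le> s ^ 4" by simp
  qed (use x in \<open>auto simp: s_def\<close>)
  have s0: "s \<le> (9/20 + x * (13/20)) * (9/20 * (9/20 + x * B))\<^sup>2"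
  proof -
    have "(9/20 + x * (13/20)) * (9/20 * (9/20 + x * B))\<^sup>2 - s = 66063/2560000
        + 18040587/12800000 * t + 6786261/12800000 * t ^ 2 + 767637/12800000 * t ^ 3"
      unfolding xB s_def unfolding t(2) by (simp add: field_simps eval_nat_numeral)
    also have "\<dots> \<ge> 0" using t by simp
    finally show ?thesis by simp
  qed
  have s1: "s \<le> (9/20 + x * (13/20)) * (13/20 * (13/20 + B))\<^sup>2"
  proof -
    have "x\<^sup>2 * ((9/20 + x * (13/20)) * (13/20 * (13/20 + B))\<^sup>2 - s)
        = (9/20 + x * (13/20)) * (13/20 * (13/20 * x + x * B))\<^sup>2 - x\<^sup>2 * s"
      by (simp add: algebra_simps power2_eq_square)
    also have "\<dots> = 834087/2560000 + 18952563/12800000 * t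
        + 16982429/12800000 * t ^ 2 + 4251373/12800000 * t ^ 3"
      unfolding xB s_def unfolding t(2) by (simp add: field_simps eval_nat_numeral)
    also have "\<dots> \<ge> 0" using t by simp
    finally show ?thesis using x by (simp add: zero_le_mult_iff)
  qed
  have s2: "s \<le> B ^ 3 * ((9/20 + x * B) * (13/20 + B))"
  proof -
    have "x ^ 4 * (B ^ 3 * ((9/20 + x * B) * (13/20 + B)) - s)
        = (x * B) ^ 3 * ((9/20 + x * B) * (13/20 * x + x * B)) - x ^ 4 * s"
      by (simp add: algebra_simps eval_nat_numeral)
    also have "\<dots> = 1674267/819200 + 9520109/4096000 * t + 18207213/10240000 * t ^ 2
        + 78916539/51200000 * t ^ 3 + 75707919/102400000 * t ^ 4 + 12806373/102400000 * t ^ 5"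
      unfolding xB s_def unfolding t(2) by (simp add: field_simps eval_nat_numeral)
    also have "\<dots> \<ge> 0" using t by simp
    finally show ?thesis using x by (simp add: zero_le_mult_iff)
  qed
  have "9/20 + x * (13/20) + 2 * (x * B) = 2 * x + 1" unfolding xB by (simp add: field_simps)
  then have "admissible 2 v ((2 * real 2 + 1) * 0.045072) (9/20) (13/20) B"
    using N s0 s1 s2 B0 unfolding admissible_def x_def[symmetric] by (simp add: mult.assoc)
  then show ?thesis by blast
qed

lemma admissible_ge_3:
  assumes "j \<ge> 3" "v \<ge> 1"
  shows "\<exists>Z A B. admissible j v ((2 * real j + 1) * delta j) Z A B"
proof (cases "v = 1")
  case True
  define r where "r = real j"
  \<comment> \<open>\<open>Z = A = 13/20\<close> makes the first two products coincide at v = 1, and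
    the normalisation gives this \<open>B\<close>.\<close>
  define B where "B = 1 - 3/10 / r"
  have r: "r \<ge> 3" using assms by (simp add: r_def)
  have B: "B \<ge> 9/10" "B \<le> 1" using r by (auto simp: B_def field_simps)
  have N: "(r + 1) powr ((2 * r + 1) * delta j) \<le> 5 / 4"
    using powr_delta_le(2)[OF assms True] True by (simp add: r_def)
  have "1 \<le> (13/20 * (13/20 + B)) ^ j"
    using B by (intro one_le_power) simp
  then have s0: "5 / 4 \<le> 13/10 * (13/20 * (13/20 + B)) ^ j" by simp
  have "53/100 \<le> exp (- (real 6 * (1/10)))"
    by (rule exp_minus_ge) (auto simp: power2_eq_square eval_nat_numeral)
  also have "\<dots> \<le> B ^ (2 * j - 1)"
    using exp_le_one_minus_power[of j "3/10"] assms r by (simp add: B_def r_def field_simps)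
  finally have e: "53/100 \<le> B ^ (2 * j - 1)" .
  have "5 / 4 \<le> 53/100 * ((31/20) * (31/20 :: real))" by simp
  also have "\<dots> \<le> B ^ (2 * j - 1) * ((13/20 + B) * (13/20 + B))"
    using B e by (intro mult_mono mult_nonneg_nonneg) auto
  finally have s2: "5 / 4 \<le> B ^ (2 * j - 1) * ((13/20 + B) * (13/20 + B))" .
  have "13/20 + 13/20 + r * B = r + 1" using r by (simp add: B_def field_simps)
  then have "admissible j v ((2 * real j + 1) * delta j) (13/20) (13/20) B"
    using N s0 s2 B unfolding admissible_def r_def[symmetric] True by simp
  then show ?thesis by blast
next
  case False
  define r where "r = real j"
  define x where "x = real v"
  define t where "t = x - 2"
  define s where "s = 5 / 4 * (1 + x / 14)"
  \<comment> \<open>Again Z = 9/20 and A = 13/20; the normalisation gives B = 1 - c / j with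
    \<open>c\<close> independent of \<open>j\<close>.\<close>
  define c where "c = (13 * x - 11) / (20 * x)"
  define B where "B = 1 - c / r"
  have r: "r \<ge> 3" using assms by (simp add: r_def)
  have t: "t \<ge> 0" "x = t + 2" using assms False by (auto simp: t_def x_def)
  have x: "x \<ge> 2" using t by simp
  have xc: "x * c = (13 * x - 11) / 20" using x by (simp add: c_def)
  have c: "3 / 8 \<le> c" "c \<le> 13 / 20" using x by (auto simp: c_def field_simps)
  have cr: "c / r \<le> c / 3" using c r by (intro divide_left_mono) auto
  have B: "B \<ge> 1 - c / 3" "B \<ge> 1 / 2" using cr c by (auto simp: B_def)
  have xB: "x * B = x - (13 * x - 11) / (20 * r)"
  proof -
    have "x * B = x - x * c / r" by (simp add: B_def right_diff_distrib)
    then show ?thesis unfolding xc by simp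
  qed
  have N: "(r * x + 1) powr ((2 * r + 1) * delta j) \<le> s"
    using powr_delta_le(1)[OF assms] by (simp add: r_def x_def s_def)
  have s0: "s \<le> (9/20 + x * (13/20)) * (9/20 * (9/20 + x * B)) ^ j"
  proof -
    \<comment> \<open>\<open>1 + y\<close> is the base of the \<open>j\<close>-th power at x = 2,
      where it is smallest. Bernoulli's inequality removes the power.\<close>
    define y where "y = 41/400 - 27/80 / r"
    have y: "-1 \<le> y" "r * y \<ge> - (3/100)" using r by (auto simp: y_def field_simps)
    have "x * B - (2 - 3/4 / r) = (x - 2) * (1 - 13/20 / r)"
      unfolding xB using r by (simp add: field_simps)
    also have "\<dots> \<ge> 0" using x r by (intro mult_nonneg_nonneg) (auto simp: field_simps)
    finally have "1 + y \<le> 9/20 * (9/20 + x * B)" by (simp add: y_def)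
    then have "(1 + y) ^ j \<le> (9/20 * (9/20 + x * B)) ^ j" using y by (intro power_mono) auto
    moreover have "1 + r * y \<le> (1 + y) ^ j" unfolding r_def by (rule Bernoulli_inequality[OF y(1)])
    ultimately have "97/100 \<le> (9/20 * (9/20 + x * B)) ^ j" using y by linarith
    then have "(9/20 + x * (13/20)) * (97/100) \<le> (9/20 + x * (13/20)) * (9/20 * (9/20 + x * B)) ^ j"
      using x by (intro mult_left_mono) auto
    moreover have "s \<le> (9/20 + x * (13/20)) * (97/100)" using x by (simp add: s_def)
    ultimately show ?thesis by linarith
  qed
  have s1: "s \<le> (9/20 + x * (13/20)) * (13/20 * (13/20 + B)) ^ j"
  proof -
    define y where "y = 29/400 - 13/20 * (c / r)"
    have y: "-1 \<le> y" "1 + r * y \<ge> 487/400 - 13/20 * c" using r c cr by (auto simp: y_def field_simps)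
    have "1 + r * y \<le> (1 + y) ^ j" unfolding r_def by (rule Bernoulli_inequality[OF y(1)])
    also have "1 + y = 13/20 * (13/20 + B)" by (simp add: y_def B_def)
    finally have "(9/20 + x * (13/20)) * (487/400 - 13/20 * c)
        \<le> (9/20 + x * (13/20)) * (13/20 * (13/20 + B)) ^ j"
      using x y by (intro mult_left_mono) auto
    moreover have "s \<le> (9/20 + x * (13/20)) * (487/400 - 13/20 * c)"
    proof -
      have "x * ((9/20 + x * (13/20)) * (487/400 - 13/20 * c) - s)
          = (9/20 + x * (13/20)) * (487/400 * x - 13/20 * (x * c)) - x * s"
        by (simp add: algebra_simps)
      also have "\<dots> = 6171/11200 + 58799/56000 * t + 11969/28000 * t ^ 2"
        unfolding xc s_def unfolding t(2) by (simp add: field_simps eval_nat_numeral)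
      also have "\<dots> \<ge> 0" using t by simp
      finally show ?thesis using x by (simp add: zero_le_mult_iff)
    qed
    ultimately show ?thesis by linarith
  qed
  have s2: "s \<le> B ^ (2 * j - 1) * ((9/20 + x * B) * (13/20 + B))"
  proof -
    \<comment> \<open>\<open>w\<close> splits exp (-2 c) into exp (-13/10), at least 0.256, and exp
      w, bounded by its Taylor polynomial.\<close>
    define w where "w = 11/10 / x"
    have w: "w \<ge> 0" "x * w = 11/10" using x by (auto simp: w_def)
    have cw: "2 * c = 13/10 - w" using x by (simp add: c_def w_def field_simps)
    have "1 / (2 * r) \<le> 1 / 6" using r by (simp add: field_simps)
    then have c_le: "c \<le> 1 - 1 / (2 * r)" using c by linarith
    have "256/1000 * (1 + w + w\<^sup>2 / 2) \<le> exp (- (real 20 * (13/200))) * exp w"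
      using w by (intro mult_mono exp_lower_Taylor_quadratic exp_minus_ge)
        (auto simp: power2_eq_square eval_nat_numeral)
    also have "\<dots> = exp (- (2 * c))" unfolding cw by (simp flip: exp_add)
    also have "\<dots> \<le> B ^ (2 * j - 1)"
      unfolding B_def r_def using assms(1) c c_le by (intro exp_le_one_minus_power) (auto simp: r_def)
    finally have "256/1000 * (1 + w + w\<^sup>2 / 2) * ((9/20 + x * (1 - c / 3)) * (13/20 + (1 - c / 3)))
        \<le> B ^ (2 * j - 1) * ((9/20 + x * B) * (13/20 + B))"
      using x B c w by (intro mult_mono add_left_mono mult_left_mono mult_nonneg_nonneg) auto
    moreover have "s \<le> 256/1000 * (1 + w + w\<^sup>2 / 2) * ((9/20 + x * (1 - c / 3)) * (13/20 + (1 - c / 3)))"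
    proof -
      have "x ^ 3 * (256/1000 * (1 + w + w\<^sup>2 / 2) * ((9/20 + x * (1 - c / 3)) * (13/20 + (1 - c / 3))) - s)
          = 256/1000 * (x\<^sup>2 + x * (x * w) + (x * w)\<^sup>2 / 2)
            * ((9/20 + (x - x * c / 3)) * (13/20 * x + (x - x * c / 3))) - x ^ 3 * s"
        by (simp add: field_simps eval_nat_numeral)
      also have "\<dots> = 142617/546875 + 1222619/2187500 * t + 6236801/4921875 * t ^ 2
          + 1208147/1312500 * t ^ 3 + 312079/1575000 * t ^ 4"
        unfolding xc w(2) s_def unfolding t(2) by (simp add: field_simps eval_nat_numeral)
      also have "\<dots> \<ge> 0" using t by simp
      finally show ?thesis using x by (simp add: zero_le_mult_iff)
    qed
    ultimately show ?thesis by linarith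
  qed
  have "9/20 + x * (13/20) + r * x * B = r * x + 1"
    using r xB by (simp add: mult.assoc) (simp add: field_simps)
  then have "admissible j v ((2 * real j + 1) * delta j) (9/20) (13/20) B"
    using N s0 s1 s2 B unfolding admissible_def x_def[symmetric] r_def[symmetric] by simp
  then show ?thesis by blast
qed

theorem theorem1:
  shows "(\<forall>j\<ge>1. \<forall>k\<ge>1. \<forall>n\<ge>1.
            real (E j k n) \<le> real k * real (kappa j n) powr (1 - delta j))
       \<and> (\<forall>k\<ge>1. \<forall>n\<ge>1.
            real (E 2 k n) \<le> real k * real (kappa 2 n) powr (1 - 0.045072))"
proof -
  have b: "real (E 2 k n) \<le> real k * real (kappa 2 n) powr (1 - 0.045072)"
    if "k \<ge> 1" "n \<ge> 1" for k n
    using that by (intro E_bound admissible_2) auto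
  have a: "real (E j k n) \<le> real k * real (kappa j n) powr (1 - delta j)"
    if jkn: "j \<ge> 1" "k \<ge> 1" "n \<ge> 1" for j k n
  proof -
    consider "j = 1" | "j = 2" | "j \<ge> 3" using jkn(1) by linarith
    then show ?thesis
    proof cases
      case 1
      show ?thesis unfolding 1 using jkn by (intro E_bound admissible_1) auto
    next
      case 2
      \<comment> \<open>As \<open>kappa\<close> is at least 1, the larger exponent saving of part
        (b) gives the stronger bound.\<close>
      have "real (kappa 2 n) \<ge> 1"
        unfolding kappa_eq_prod[OF jkn(3)] by (intro prod_ge_1) simp
      then have "real (kappa 2 n) powr (1 - 0.045072) \<le> real (kappa 2 n) powr (1 - delta 2)"
        using delta_2_le by (intro powr_mono) auto
      then have "real k * real (kappa 2 n) powr (1 - 0.045072)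
          \<le> real k * real (kappa 2 n) powr (1 - delta 2)" by (rule mult_left_mono) simp
      then show ?thesis unfolding 2 using b[OF jkn(2,3)] by linarith
    next
      case 3
      then show ?thesis using jkn by (intro E_bound admissible_ge_3) auto
    qed
  qed
  show ?thesis using a b by blast
qed

end
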